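(* Let $(p_n)_{n \ge 1}$ and $(q_n)_{n \ge 1}$ be strictly increasing sequences of primes with $100 < q_1$ and $q_n < p_n < q_{n+1}$ for all $n \in \mathbb{N}$, and set $\alpha_n := q_n/p_n$; assume $\alpha_1 < \frac{1}{200}$ and $\alpha_{n+1} < \frac12 \alpha_n$ for all $n$. Let $A_2 := \{\alpha_{j_k} + \sum_{i=1}^{\ell} \alpha_{j_i} : \ell \in \mathbb{N},\ k \in \{1,\dots,\ell\},\ j_1,\dots,j_\ell \in \mathbb{N} \text{ distinct}\}$, $A_3 := \{2\alpha_{j_k} + \sum_{i=1}^{\ell} \alpha_{j_i} : \ell \in \mathbb{N},\ k \in \{1,\dots,\ell\},\ j_1,\dots,j_\ell \in \mathbb{N} \text{ distinct}\}$, $B := \{\beta_0 := 1\} \cup \{\beta_\ell := 1 - \sum_{i=1}^\ell \alpha_i : \ell \in \mathbb{N}\}$, and let $M$ be the additive submonoid of $\mathbb{Q}$ generated by $A_2 \cup A_3 \cup B$. Then for every field $F$, the monoid algebra $F[M]$ satisfies the almost ACCP.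
   Context: $F[M]$ is the integral domain of polynomial expressions $\sum c_i x^{m_i}$ with $c_i \in F$, $m_i \in M$. An element of a (cancellative commutative) monoid $H$ is atomic if it is a unit or a finite product of atoms (non-units $a$ such that $a = bc$ forces $b$ or $c$ to be a unit). An element $b$ satisfies the ACCP if every ascending chain of principal ideals starting at $bH$ stabilizes. $H$ satisfies the almost ACCP if for every finite nonempty $S \subseteq H$ there exist an atomic common divisor $d$ of $S$ in $H$ and $s \in S$ such that $s/d$ satisfies the ACCP. An integral domain satisfies the almost ACCP if its multiplicative monoid of nonzero elements does. *)

theory Defs
  imports Complex_Main "HOL-Library.Poly_Mapping" "HOL-Computational_Algebra.Primes"
begin

definition unit_in :: "'a::comm_monoid_mult set \<Rightarrow> 'a \<Rightarrow> bool" where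
  "unit_in H u \<longleftrightarrow> u \<in> H \<and> (\<exists>v\<in>H. u * v = 1)"

definition dvd_in :: "'a::comm_monoid_mult set \<Rightarrow> 'a \<Rightarrow> 'a \<Rightarrow> bool" where
  "dvd_in H a b \<longleftrightarrow> a \<in> H \<and> b \<in> H \<and> (\<exists>c\<in>H. b = a * c)"

definition atom_in :: "'a::comm_monoid_mult set \<Rightarrow> 'a \<Rightarrow> bool" where
  "atom_in H a \<longleftrightarrow> a \<in> H \<and> \<not> unit_in H a \<and>
     (\<forall>b\<in>H. \<forall>c\<in>H. a = b * c \<longrightarrow> unit_in H b \<or> unit_in H c)"

definition atomic_in :: "'a::comm_monoid_mult set \<Rightarrow> 'a \<Rightarrow> bool" where
  "atomic_in H b \<longleftrightarrow> b \<in> H \<and>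
     (unit_in H b \<or> (\<exists>xs. xs \<noteq> [] \<and> (\<forall>x\<in>set xs. atom_in H x) \<and> b = prod_list xs))"

definition pideal :: "'a::comm_monoid_mult set \<Rightarrow> 'a \<Rightarrow> 'a set" where
  "pideal H a = {a * c | c. c \<in> H}"

definition accp_elem :: "'a::comm_monoid_mult set \<Rightarrow> 'a \<Rightarrow> bool" where
  "accp_elem H b \<longleftrightarrow> b \<in> H \<and>
     (\<forall>f::nat \<Rightarrow> 'a. f 0 = b \<and> (\<forall>n. f n \<in> H \<and> pideal H (f n) \<subseteq> pideal H (f (Suc n)))
        \<longrightarrow> (\<exists>N. \<forall>n\<ge>N. pideal H (f n) = pideal H (f N)))"

definition almost_accp :: "'a::comm_monoid_mult set \<Rightarrow> bool" where
  "almost_accp H \<longleftrightarrow>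
     (\<forall>S. finite S \<and> S \<noteq> {} \<and> S \<subseteq> H \<longrightarrow>
        (\<exists>d s. atomic_in H d \<and> (\<forall>x\<in>S. dvd_in H d x) \<and> s \<in> S \<and>
               (\<exists>c\<in>H. s = d * c \<and> accp_elem H c)))"

text \<open>F[M] is realised as the subring of F[\<rat>] = finitely supported maps rat to F, of elements supported in M;
  its multiplicative monoid of nonzero elements:\<close>
definition monoid_alg_nonzero :: "rat set \<Rightarrow> (rat \<Rightarrow>\<^sub>0 'a::field) set" where
  "monoid_alg_nonzero M = {f. f \<noteq> 0 \<and> Poly_Mapping.keys f \<subseteq> M}"

definition domain_almost_accp_monoid_alg :: "rat set \<Rightarrow> 'a::field itself \<Rightarrow> bool" where
  "domain_almost_accp_monoid_alg M _ \<longleftrightarrow> almost_accp (monoid_alg_nonzero M :: (rat \<Rightarrow>\<^sub>0 'a) set)"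

inductive_set add_submonoid_gen :: "'b::monoid_add set \<Rightarrow> 'b set" for G where
  zero: "0 \<in> add_submonoid_gen G"
| gen: "x \<in> G \<Longrightarrow> x \<in> add_submonoid_gen G"
| add: "x \<in> add_submonoid_gen G \<Longrightarrow> y \<in> add_submonoid_gen G \<Longrightarrow> x + y \<in> add_submonoid_gen G"

end

theory Submission
  imports Defs
begin

text \<open>
  A number \<open>r\<close> in \<open>M\<close> is a sum of some \<open>\<beta> l\<close> and of a combination of the \<open>\<alpha> n\<close> that is zero or has a
  coefficient at least 2.  Expanding each \<open>\<beta> l\<close> into \<open>1\<close> minus a sum of \<open>\<alpha> n\<close>, the total coefficient of
  \<open>\<alpha> n\<close> is determined by \<open>r\<close> modulo \<open>p n\<close>, hence uniquely for all \<open>n\<close> with \<open>q n\<close> large against \<open>r\<close>, and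
  these coefficients are additive.

  If some exponent \<open>t\<close> of \<open>g\<close> cannot be written with two or more \<open>\<beta> l\<close>, then the degrees of the
  nonconstant divisors of \<open>g\<close> are bounded away from 0, so \<open>g\<close> satisfies the ACCP.  A finite set \<open>S\<close> is
  reduced to this case by dividing it by \<open>x\<close> raised to \<open>k * \<beta> L\<close>, a power of an atom, where \<open>L\<close> is large
  and \<open>k\<close> is the least, over all exponents occurring in \<open>S\<close>, of the maximal number of \<open>\<beta> l\<close>.
\<close>

section \<open>Supports of products\<close>

lemma lookup_mult_group:
  fixes f g :: "'b::ab_group_add \<Rightarrow>\<^sub>0 'a::semiring_0"
  shows "Poly_Mapping.lookup (f * g) s
    = (\<Sum>u\<in>Poly_Mapping.keys f. Poly_Mapping.lookup f u * Poly_Mapping.lookup g (s - u))"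
proof -
  \<comment> \<open>In a group, \<open>q\<close> is determined by \<open>s\<close> and
    \<open>l\<close>, so the inner sum has one term.\<close>
  have *: "(\<Sum>q. Poly_Mapping.lookup g q when s = l + q) = Poly_Mapping.lookup g (s - l)" for l
  proof -
    have "(\<Sum>q. Poly_Mapping.lookup g q when s = l + q) = (\<Sum>q. Poly_Mapping.lookup g q when q = s - l)"
      by (rule Sum_any.cong) (auto simp: algebra_simps when_def)
    then show ?thesis by simp
  qed
  show ?thesis unfolding lookup_mult *
    by (rule Sum_any.expand_superset) (auto simp: in_keys_iff)
qed

lemma keys_mult_sum:
  fixes f g :: "'b::ab_group_add \<Rightarrow>\<^sub>0 'a::semiring_0"
  assumes "s \<in> Poly_Mapping.keys (f * g)"
  obtains u v where "u \<in> Poly_Mapping.keys f" "v \<in> Poly_Mapping.keys g" "s = u + v"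
proof -
  from assms have "(\<Sum>u\<in>Poly_Mapping.keys f. Poly_Mapping.lookup f u * Poly_Mapping.lookup g (s - u)) \<noteq> 0"
    by (simp add: in_keys_iff lookup_mult_group)
  then obtain u where "u \<in> Poly_Mapping.keys f" "Poly_Mapping.lookup f u * Poly_Mapping.lookup g (s - u) \<noteq> 0"
    by (meson sum.neutral)
  then show thesis by (intro that[of u "s - u"]) (auto simp: in_keys_iff)
qed

text \<open>If \<open>a + b\<close> arises only once, the convolution has a single nonzero summand
  there, and without zero divisors it cannot vanish.\<close>

lemma keys_mult_unique_sum:
  fixes f g :: "'b::ab_group_add \<Rightarrow>\<^sub>0 'a::semiring_no_zero_divisors"
  assumes ab: "a \<in> Poly_Mapping.keys f" "b \<in> Poly_Mapping.keys g"
    and unique: "\<And>u v. u \<in> Poly_Mapping.keys f \<Longrightarrow> v \<in> Poly_Mapping.keys g \<Longrightarrow> u + v = a + b \<Longrightarrow> u = a"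
  shows "a + b \<in> Poly_Mapping.keys (f * g)"
proof -
  have "Poly_Mapping.lookup (f * g) (a + b)
      = (\<Sum>u\<in>Poly_Mapping.keys f. if u = a then Poly_Mapping.lookup f a * Poly_Mapping.lookup g b else 0)"
    unfolding lookup_mult_group
  proof (rule sum.cong)
    fix u assume u: "u \<in> Poly_Mapping.keys f"
    show "Poly_Mapping.lookup f u * Poly_Mapping.lookup g (a + b - u)
        = (if u = a then Poly_Mapping.lookup f a * Poly_Mapping.lookup g b else 0)"
    proof (cases "u = a")
      case False
      with unique[OF u, of "a + b - u"] have "a + b - u \<notin> Poly_Mapping.keys g" by auto
      with False show ?thesis by (simp add: in_keys_iff)
    qed simp
  qed simp
  also have "\<dots> = Poly_Mapping.lookup f a * Poly_Mapping.lookup g b" using ab by simp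
  finally show ?thesis using ab by (simp add: in_keys_iff)
qed

text \<open>The pair is chosen by maximising lexicographically, first \<open>e\<close> and then the exponent itself;
  this makes its sum unrepeated.\<close>

lemma keys_mult_maximal:
  fixes f g :: "'b::linordered_ab_group_add \<Rightarrow>\<^sub>0 'a::semiring_no_zero_divisors"
    and e :: "'b \<Rightarrow> 'c::linordered_ab_group_add"
  assumes nz: "f \<noteq> 0" "g \<noteq> 0"
    and add: "\<And>u v. u \<in> Poly_Mapping.keys f \<Longrightarrow> v \<in> Poly_Mapping.keys g \<Longrightarrow> e (u + v) = e u + e v"
  obtains a b where "a \<in> Poly_Mapping.keys f" "b \<in> Poly_Mapping.keys g"
    "\<And>u. u \<in> Poly_Mapping.keys f \<Longrightarrow> e u \<le> e a" "\<And>v. v \<in> Poly_Mapping.keys g \<Longrightarrow> e v \<le> e b"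
    "a + b \<in> Poly_Mapping.keys (f * g)"
proof -
  have lexmax: "\<exists>a\<in>Poly_Mapping.keys h. \<forall>u\<in>Poly_Mapping.keys h. e u \<le> e a \<and> (e u = e a \<longrightarrow> u \<le> a)"
    if "h \<noteq> 0" for h :: "'b \<Rightarrow>\<^sub>0 'a"
  proof -
    let ?K = "Poly_Mapping.keys h"
    let ?T = "{u \<in> ?K. e u = Max (e ` ?K)}"
    have "?K \<noteq> {}" using that by simp
    then have "Max (e ` ?K) \<in> e ` ?K" by (intro Max_in) auto
    then have "?T \<noteq> {}" by force
    then have "Max ?T \<in> ?T" by (intro Max_in) auto
    then have in_K: "Max ?T \<in> ?K" and eq: "e (Max ?T) = Max (e ` ?K)" by auto
    show ?thesis
    proof (intro bexI[OF _ in_K] ballI conjI impI)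
      fix u assume "u \<in> ?K"
      then show "e u \<le> e (Max ?T)" unfolding eq by simp
    next
      fix u assume "u \<in> ?K" "e u = e (Max ?T)"
      then show "u \<le> Max ?T" unfolding eq by (intro Max_ge) auto
    qed
  qed
  from lexmax[OF nz(1)] lexmax[OF nz(2)] obtain a b where
    a: "a \<in> Poly_Mapping.keys f" "\<And>u. u \<in> Poly_Mapping.keys f \<Longrightarrow> e u \<le> e a"
      "\<And>u. u \<in> Poly_Mapping.keys f \<Longrightarrow> e u = e a \<Longrightarrow> u \<le> a" and
    b: "b \<in> Poly_Mapping.keys g" "\<And>u. u \<in> Poly_Mapping.keys g \<Longrightarrow> e u \<le> e b"
      "\<And>u. u \<in> Poly_Mapping.keys g \<Longrightarrow> e u = e b \<Longrightarrow> u \<le> b"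
    by blast
  have "a + b \<in> Poly_Mapping.keys (f * g)"
  proof (rule keys_mult_unique_sum[OF a(1) b(1)])
    fix u v assume uv: "u \<in> Poly_Mapping.keys f" "v \<in> Poly_Mapping.keys g" and s: "u + v = a + b"
    have "e u + e v = e a + e b" using add[OF uv] add[OF a(1) b(1)] s by simp
    then have "e u = e a" "e v = e b"
      using a(2)[OF uv(1)] b(2)[OF uv(2)]
      by (metis add_less_le_mono add_le_less_mono antisym_conv1 less_irrefl order_le_less)+
    then have "u \<le> a" "v \<le> b" using a(3) b(3) uv by auto
    with s show "u = a" by (metis add_less_le_mono less_irrefl order_le_less)
  qed
  with a b that show thesis by blast
qed

lemma degree_mult:
  fixes f g :: "'b::linordered_ab_group_add \<Rightarrow>\<^sub>0 'a::semiring_no_zero_divisors"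
  assumes "f \<noteq> 0" "g \<noteq> 0"
  shows "Max (Poly_Mapping.keys (f * g)) = Max (Poly_Mapping.keys f) + Max (Poly_Mapping.keys g)"
proof -
  obtain a b where a: "a \<in> Poly_Mapping.keys f" "b \<in> Poly_Mapping.keys g"
    "\<And>u. u \<in> Poly_Mapping.keys f \<Longrightarrow> u \<le> a" "\<And>v. v \<in> Poly_Mapping.keys g \<Longrightarrow> v \<le> b"
    "a + b \<in> Poly_Mapping.keys (f * g)"
    using keys_mult_maximal[OF assms, where e = "\<lambda>x. x"] by blast
  have "Max (Poly_Mapping.keys f) = a" "Max (Poly_Mapping.keys g) = b"
    using a by (auto intro!: Max_eqI)
  moreover have "Max (Poly_Mapping.keys (f * g)) = a + b"
  proof (rule Max_eqI)
    fix s assume "s \<in> Poly_Mapping.keys (f * g)"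
    then show "s \<le> a + b" by (rule keys_mult_sum) (use a add_mono in blast)
  qed (use a in auto)
  ultimately show ?thesis by simp
qed

text \<open>A pair maximising \<open>e\<close> yields a surviving exponent, and so does a pair
  minimising it, obtained from \<open>- e\<close>. Both sums are \<open>c\<close>, which squeezes
  every other pair. Additivity is asked for on the supports only, because \<open>coord n\<close> is
  shown to be additive only for exponents small against \<open>q n\<close>.\<close>

lemma factor_of_homogeneous:
  fixes f g :: "'b::linordered_ab_group_add \<Rightarrow>\<^sub>0 'a::semiring_no_zero_divisors"
    and e :: "'b \<Rightarrow> 'c::linordered_ab_group_add"
  assumes add: "\<And>u v. u \<in> Poly_Mapping.keys f \<Longrightarrow> v \<in> Poly_Mapping.keys g \<Longrightarrow> e (u + v) = e u + e v"
    and const: "\<And>s. s \<in> Poly_Mapping.keys (f * g) \<Longrightarrow> e s = c"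
    and uv: "u \<in> Poly_Mapping.keys f" "v \<in> Poly_Mapping.keys g"
  shows "e u + e v = c"
proof (rule antisym)
  have nz: "f \<noteq> 0" "g \<noteq> 0" using uv by auto
  from keys_mult_maximal[OF nz add] obtain a b where
    "a \<in> Poly_Mapping.keys f" "b \<in> Poly_Mapping.keys g" "e u \<le> e a" "e v \<le> e b"
    "a + b \<in> Poly_Mapping.keys (f * g)"
    using uv by metis
  then show "e u + e v \<le> c" using const add add_mono by metis
  have add': "- e (u + v) = - e u + - e v"
    if "u \<in> Poly_Mapping.keys f" "v \<in> Poly_Mapping.keys g" for u v
    using add[OF that] by simp
  from keys_mult_maximal[OF nz, where e = "\<lambda>x. - e x", OF add'] obtain a b where
    "a \<in> Poly_Mapping.keys f" "b \<in> Poly_Mapping.keys g" "- e u \<le> - e a" "- e v \<le> - e b"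
    "a + b \<in> Poly_Mapping.keys (f * g)"
    using uv by metis
  then show "c \<le> e u + e v" using const add add_mono by (metis neg_le_iff_le)
qed

lemma keys_monomial_mult:
  fixes f :: "'b::ab_group_add \<Rightarrow>\<^sub>0 'a::semiring_1"
  shows "Poly_Mapping.keys (Poly_Mapping.single m 1 * f) = (+) m ` Poly_Mapping.keys f"
proof -
  have *: "Poly_Mapping.lookup (Poly_Mapping.single m 1 * f) s = Poly_Mapping.lookup f (s - m)" for s
    by (cases "(1::'a) = 0") (simp_all add: lookup_mult_group)
  show ?thesis
  proof (intro set_eqI iffI)
    fix s assume "s \<in> Poly_Mapping.keys (Poly_Mapping.single m 1 * f)"
    then have "s - m \<in> Poly_Mapping.keys f" by (simp add: in_keys_iff *)
    then show "s \<in> (+) m ` Poly_Mapping.keys f" by (rule rev_image_eqI) simp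
  qed (auto simp: in_keys_iff *)
qed

section \<open>Units, atoms and the ACCP in monoid algebras\<close>

lemma eventually_stationary:
  fixes D :: "nat \<Rightarrow> 'a::floor_ceiling"
  assumes nonneg: "\<And>n. 0 \<le> D n" and "\<delta> > 0"
    and step: "\<And>n. P n \<or> D (Suc n) + \<delta> \<le> D n"
    and mono: "\<And>n. D (Suc n) \<le> D n"
  shows "\<exists>N. \<forall>n\<ge>N. P n"
proof -
  define K where "K n = nat \<lfloor>D n / \<delta>\<rfloor>" for n
  have "decseq D" using mono by (simp add: decseq_Suc_iff)
  \<comment> \<open>Past the minimum of \<open>K\<close>, a failure of \<open>P\<close> would lower
    \<open>D\<close> by \<open>\<delta>\<close> and thus push the rounded quotient below that
    minimum.\<close>
  obtain N where N: "\<And>n. K N \<le> K n"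
    using ex_has_least_nat[of "\<lambda>_. True" 0 K] by auto
  have "P n" if "n \<ge> N" for n
  proof (rule ccontr)
    assume "\<not> P n"
    with step[of n] have "D (Suc n) + \<delta> \<le> D n" by simp
    moreover have "D n \<le> D N" using \<open>decseq D\<close> that by (auto simp: decseq_def)
    ultimately have "(D (Suc n) + \<delta>) / \<delta> \<le> D N / \<delta>"
      using \<open>\<delta> > 0\<close> by (intro divide_right_mono) auto
    then have "D (Suc n) / \<delta> + 1 \<le> D N / \<delta>" using \<open>\<delta> > 0\<close> by (simp add: add_divide_distrib)
    then have "\<lfloor>D (Suc n) / \<delta>\<rfloor> + 1 \<le> \<lfloor>D N / \<delta>\<rfloor>" by (simp add: le_floor_iff) linarith
    moreover have "0 \<le> \<lfloor>D (Suc n) / \<delta>\<rfloor>" using nonneg \<open>\<delta> > 0\<close> by simp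
    ultimately have "K (Suc n) < K N" unfolding K_def by linarith
    with N[of "Suc n"] show False by simp
  qed
  then show ?thesis by blast
qed

lemma monoid_alg_mult:
  fixes f g :: "rat \<Rightarrow>\<^sub>0 'a::field"
  assumes add: "\<And>u v. u \<in> M \<Longrightarrow> v \<in> M \<Longrightarrow> u + v \<in> M"
    and "f \<in> monoid_alg_nonzero M" "g \<in> monoid_alg_nonzero M"
  shows "f * g \<in> monoid_alg_nonzero M"
  using assms unfolding monoid_alg_nonzero_def by (auto elim!: keys_mult_sum)

lemma monoid_alg_one:
  assumes "0 \<in> M"
  shows "1 \<in> (monoid_alg_nonzero M :: (rat \<Rightarrow>\<^sub>0 'a::field) set)"
  using assms unfolding monoid_alg_nonzero_def by auto

lemma keys_singletonD:
  assumes "Poly_Mapping.keys f = {a}"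
  obtains c where "c \<noteq> 0" "f = Poly_Mapping.single a c"
proof
  show "Poly_Mapping.lookup f a \<noteq> 0" using assms by (simp flip: in_keys_iff)
  show "f = Poly_Mapping.single a (Poly_Mapping.lookup f a)"
    using assms by (intro poly_mapping_eqI) (auto simp: lookup_single when_def simp flip: not_in_keys_iff_lookup_eq_zero)
qed

lemma monoid_alg_unit:
  fixes f :: "rat \<Rightarrow>\<^sub>0 'a::field"
  assumes "0 \<in> M" "Poly_Mapping.keys f = {0}"
  shows "unit_in (monoid_alg_nonzero M) f"
proof -
  obtain c where c: "c \<noteq> 0" "f = Poly_Mapping.single 0 c"
    using keys_singletonD[OF assms(2)] .
  have "f * Poly_Mapping.single 0 (inverse c) = 1"
    using c by (simp add: mult_single)
  moreover have "Poly_Mapping.single 0 (inverse c) \<in> monoid_alg_nonzero M" "f \<in> monoid_alg_nonzero M"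
    using c assms by (auto simp: monoid_alg_nonzero_def simp flip: keys_eq_empty)
  ultimately show ?thesis unfolding unit_in_def by blast
qed

text \<open>Exponents add up to \<open>b\<close> across every pair of terms of a factorization, so
  both factors are monomials; indecomposability of \<open>b\<close> makes one of them a
  constant.\<close>

lemma monomial_atom:
  assumes M: "0 \<in> M" "\<And>a. a \<in> M \<Longrightarrow> 0 \<le> a"
    and b: "b \<in> M" "b \<noteq> 0" "\<And>u v. u \<in> M \<Longrightarrow> v \<in> M \<Longrightarrow> u + v = b \<Longrightarrow> u = 0 \<or> v = 0"
  shows "atom_in (monoid_alg_nonzero M) (Poly_Mapping.single b (1::'a::field))"
  unfolding atom_in_def
proof (intro conjI ballI impI)
  let ?H = "monoid_alg_nonzero M :: (rat \<Rightarrow>\<^sub>0 'a) set"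
  let ?b = "Poly_Mapping.single b (1::'a)"
  have sums: "u + v = s" if "f * g = Poly_Mapping.single s 1"
    "u \<in> Poly_Mapping.keys f" "v \<in> Poly_Mapping.keys g"
    for s u v and f g :: "rat \<Rightarrow>\<^sub>0 'a"
    using factor_of_homogeneous[of f g "\<lambda>x. x" s u v] that by simp
  show "?b \<in> ?H" using b(1) by (simp add: monoid_alg_nonzero_def flip: keys_eq_empty)
  show "\<not> unit_in ?H ?b"
  proof
    assume "unit_in ?H ?b"
    then obtain g where g: "g \<in> ?H" "?b * g = 1" unfolding unit_in_def by blast
    then obtain v where v: "v \<in> Poly_Mapping.keys g" "v \<in> M"
      unfolding monoid_alg_nonzero_def by (metis (mono_tags) equals0I keys_eq_empty mem_Collect_eq subsetD)
    have "b + v = 0" using sums[of ?b g 0 b v] g v by simp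
    with M(2)[OF b(1)] M(2)[OF v(2)] b(2) show False by simp
  qed
  fix f g assume f: "f \<in> ?H" and g: "g \<in> ?H" and fg: "?b = f * g"
  obtain u v where u: "u \<in> Poly_Mapping.keys f" "u \<in> M" and v: "v \<in> Poly_Mapping.keys g" "v \<in> M"
    using f g unfolding monoid_alg_nonzero_def
    by (metis (mono_tags) equals0I keys_eq_empty mem_Collect_eq subsetD)
  have "Poly_Mapping.keys f = {u}" "Poly_Mapping.keys g = {v}" "u + v = b"
    using sums[of f g b] fg u v by (auto simp: add_right_cancel) (metis add_right_cancel, metis add_left_cancel)
  with b(3)[OF u(2) v(2)] monoid_alg_unit[OF M(1)] show "unit_in ?H f \<or> unit_in ?H g" by auto
qed

text \<open>Degrees add, so each step of the chain with a nonconstant cofactor lowers the degree by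
  at least \<open>\<delta>\<close>. This happens finitely often, and constant cofactors leave the
  ideal unchanged.\<close>

lemma accp_elem_of_degree_gap:
  fixes g :: "rat \<Rightarrow>\<^sub>0 'a::field" and M :: "rat set"
  defines "H \<equiv> monoid_alg_nonzero M"
  assumes M: "0 \<in> M" "\<And>a. a \<in> M \<Longrightarrow> 0 \<le> a" "\<And>u v. u \<in> M \<Longrightarrow> v \<in> M \<Longrightarrow> u + v \<in> M"
    and g: "g \<in> H" and "\<delta> > 0"
    and gap: "\<And>g' h. g' \<in> H \<Longrightarrow> h \<in> H \<Longrightarrow> g = g' * h \<Longrightarrow>
        Poly_Mapping.keys h = {0} \<or> \<delta> \<le> Max (Poly_Mapping.keys h)"
  shows "accp_elem H g"
  unfolding accp_elem_def
proof (intro conjI allI impI)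
  fix f :: "nat \<Rightarrow> rat \<Rightarrow>\<^sub>0 'a"
  assume f: "f 0 = g \<and> (\<forall>n. f n \<in> H \<and> pideal H (f n) \<subseteq> pideal H (f (Suc n)))"
  have one: "1 \<in> H" and mult: "\<And>a b. a \<in> H \<Longrightarrow> b \<in> H \<Longrightarrow> a * b \<in> H"
    unfolding H_def using monoid_alg_one monoid_alg_mult M by blast+
  have nz: "a \<noteq> 0" if "a \<in> H" for a using that by (simp add: H_def monoid_alg_nonzero_def)
  have deg_nonneg: "0 \<le> Max (Poly_Mapping.keys a)" if "a \<in> H" for a
  proof -
    have "Max (Poly_Mapping.keys a) \<in> Poly_Mapping.keys a" using nz[OF that] by (intro Max_in) auto
    then have "Max (Poly_Mapping.keys a) \<in> M" using that by (auto simp: H_def monoid_alg_nonzero_def)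
    then show ?thesis by (rule M(2))
  qed
  have "\<exists>c\<in>H. f n = f (Suc n) * c" for n
  proof -
    have "f n * 1 \<in> pideal H (f n)" using one unfolding pideal_def by blast
    with f have "f n \<in> pideal H (f (Suc n))" by auto
    then show ?thesis unfolding pideal_def by blast
  qed
  then obtain c where c: "c n \<in> H" "f n = f (Suc n) * c n" for n by metis
  have dvd_g: "\<exists>b\<in>H. g = f n * b" for n
  proof (induction n)
    case 0
    show ?case using f one by (intro bexI[of _ 1]) auto
  next
    case (Suc n)
    then obtain b where "b \<in> H" "g = f n * b" by blast
    then show ?case using c[of n] mult by (intro bexI[of _ "c n * b"]) (auto simp: mult.assoc)
  qed
  \<comment> \<open>The gap concerns divisors of \<open>g\<close>, and \<open>c n\<close> is one
    because \<open>f n\<close> divides \<open>g\<close>.\<close>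
  have c_gap: "Poly_Mapping.keys (c n) = {0} \<or> \<delta> \<le> Max (Poly_Mapping.keys (c n))" for n
  proof -
    obtain b where b: "b \<in> H" "g = f n * b" using dvd_g by blast
    have "g = (f (Suc n) * b) * c n" using b c(2)[of n] by (metis mult.assoc mult.commute)
    with gap[of "f (Suc n) * b" "c n"] f b c mult show ?thesis by blast
  qed
  have deg: "Max (Poly_Mapping.keys (f n))
      = Max (Poly_Mapping.keys (f (Suc n))) + Max (Poly_Mapping.keys (c n))" for n
    using degree_mult[of "f (Suc n)" "c n"] c[of n] f nz by metis
  have "\<exists>N. \<forall>n\<ge>N. Poly_Mapping.keys (c n) = {0}"
    using \<open>\<delta> > 0\<close>
  proof (rule eventually_stationary[rotated])
    fix n
    show "Poly_Mapping.keys (c n) = {0}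
        \<or> Max (Poly_Mapping.keys (f (Suc n))) + \<delta> \<le> Max (Poly_Mapping.keys (f n))"
      using c_gap[of n] deg[of n] by auto
    show "Max (Poly_Mapping.keys (f (Suc n))) \<le> Max (Poly_Mapping.keys (f n))"
      using deg[of n] deg_nonneg[OF c(1)[of n]] by simp
    show "0 \<le> Max (Poly_Mapping.keys (f n))" using deg_nonneg f by blast
  qed
  then obtain N where N: "\<And>n. n \<ge> N \<Longrightarrow> Poly_Mapping.keys (c n) = {0}" by blast
  have "pideal H (f n) = pideal H (f N)" if "n \<ge> N" for n
    using that
  proof (induction n rule: dec_induct)
    case (step n)
    have "unit_in H (c n)" using monoid_alg_unit[OF M(1) N] step(1) unfolding H_def by simp
    then obtain d where d: "d \<in> H" "c n * d = 1" unfolding unit_in_def by blast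
    have "f (Suc n) = f n * d" using c(2)[of n] d(2) by (simp add: mult.assoc)
    then have "pideal H (f (Suc n)) \<subseteq> pideal H (f n)"
      using mult d(1) unfolding pideal_def by (auto simp: mult.assoc)
    with f step(3) show ?case by auto
  qed simp
  then show "\<exists>N. \<forall>n\<ge>N. pideal H (f n) = pideal H (f N)" by blast
qed (rule g)

section \<open>Auxiliary facts on sums\<close>

lemma add_submonoid_gen_sum:
  fixes f :: "'i \<Rightarrow> 'b::comm_monoid_add"
  assumes "\<And>i. i \<in> I \<Longrightarrow> f i \<in> add_submonoid_gen G"
  shows "sum f I \<in> add_submonoid_gen G"
  using assms by (induction I rule: infinite_finite_induct) (auto intro: add_submonoid_gen.intros)

text \<open>Exchanging the two sums turns indicators into counts. The base value \<open>a\<close> is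
  1 in one use and \<open>\<beta> L\<close> in the other.\<close>

lemma sum_list_map_indicator_sum:
  fixes w :: "'i \<Rightarrow> 'b::comm_ring_1"
  assumes "finite I" "\<And>l. l \<in> set ls \<Longrightarrow> b l = a + (\<Sum>i\<in>I. if P l i then w i else 0)"
  shows "sum_list (map b ls)
      = of_nat (length ls) * a + (\<Sum>i\<in>I. of_nat (length (filter (\<lambda>l. P l i) ls)) * w i)"
  using assms(2)
proof (induction ls)
  case (Cons l ls)
  have "(\<Sum>i\<in>I. of_nat (length (filter (\<lambda>l. P l i) (l # ls))) * w i)
      = (\<Sum>i\<in>I. if P l i then w i else 0) + (\<Sum>i\<in>I. of_nat (length (filter (\<lambda>l. P l i) ls)) * w i)"
    unfolding sum.distrib[symmetric] by (rule sum.cong) (auto simp: algebra_simps)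
  with Cons show ?case by (simp add: algebra_simps)
qed simp

section \<open>The sequences and the generators of the monoid\<close>

locale prime_ratios =
  fixes p q :: "nat \<Rightarrow> nat" and \<alpha> :: "nat \<Rightarrow> rat"
  assumes prime_p: "\<And>n. 1 \<le> n \<Longrightarrow> prime (p n)"
    and prime_q: "\<And>n. 1 \<le> n \<Longrightarrow> prime (q n)"
    and p_Suc: "\<And>n. 1 \<le> n \<Longrightarrow> p n < p (Suc n)"
    and q_Suc: "\<And>n. 1 \<le> n \<Longrightarrow> q n < q (Suc n)"
    and q_1: "100 < q 1"
    and q_less_p: "\<And>n. 1 \<le> n \<Longrightarrow> q n < p n"
    and \<alpha>_eq: "\<And>n. \<alpha> n = of_nat (q n) / of_nat (p n)"
    and \<alpha>_1: "\<alpha> 1 < 1 / 200"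
    and \<alpha>_Suc: "\<And>n. 1 \<le> n \<Longrightarrow> \<alpha> (Suc n) < \<alpha> n / 2"
begin

definition \<beta> :: "nat \<Rightarrow> rat" where
  "\<beta> l = 1 - (\<Sum>i=1..l. \<alpha> i)"

text \<open>Finite sets \<open>X\<close> replace the lists of distinct indices: \<open>k = 1\<close>
  gives \<open>A2\<close>, \<open>k = 2\<close> gives \<open>A3\<close>, and
  \<open>range \<beta>\<close> is \<open>B\<close>.\<close>

definition gens :: "rat set" where
  "gens = {of_nat k * \<alpha> m + sum \<alpha> X | k m X. k \<in> {1, 2} \<and> finite X \<and> X \<subseteq> {1..} \<and> m \<in> X} \<union> range \<beta>"

abbreviation M :: "rat set" where
  "M \<equiv> add_submonoid_gen gens"

lemma p_pos: "1 \<le> n \<Longrightarrow> 0 < p n"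
  using q_less_p[of n] by simp

lemma p_less:
  assumes "1 \<le> m" "m < n"
  shows "p m < p n"
proof -
  from \<open>m < n\<close> have "Suc m \<le> n" by simp
  then show ?thesis
  proof (induction n rule: dec_induct)
    case base
    show ?case using p_Suc assms(1) .
  next
    case (step n)
    then show ?case using p_Suc[of n] assms(1) by simp
  qed
qed

lemma q_ge: "1 \<le> n \<Longrightarrow> 100 + n \<le> q n"
proof (induction n rule: dec_induct)
  case base
  show ?case using q_1 by simp
next
  case (step n)
  then show ?case using q_Suc[of n] by simp
qed

lemma q_eventually_greater: "\<forall>\<^sub>F n in sequentially. (r::rat) < of_nat (q n)"
proof -
  obtain m :: nat where m: "r < of_nat m" using reals_Archimedean2 by blast
  have "r < of_nat (q n)" if "n \<ge> Suc m" for n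
  proof -
    have "m \<le> q n" using q_ge[of n] that by simp
    then have "(of_nat m :: rat) \<le> of_nat (q n)" by (rule of_nat_mono)
    with m show ?thesis by linarith
  qed
  then show ?thesis unfolding eventually_sequentially by blast
qed

lemma \<alpha>_pos: "1 \<le> n \<Longrightarrow> 0 < \<alpha> n"
  using prime_gt_0_nat[OF prime_p] prime_gt_0_nat[OF prime_q] by (simp add: \<alpha>_eq)

lemma \<alpha>_antimono:
  assumes "1 \<le> m" "m \<le> n"
  shows "\<alpha> n \<le> \<alpha> m"
  using assms(2)
proof (induction n rule: dec_induct)
  case (step n)
  then show ?case using \<alpha>_Suc[of n] \<alpha>_pos[of n] assms(1) by linarith
qed simp

lemma sum_\<alpha>_le: "(\<Sum>i=1..l. \<alpha> i) \<le> 1 / 100"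
proof (cases l)
  case (Suc k)
  \<comment> \<open>Subtracting the last term strengthens the bound enough for induction, since the
    next term is less than half of it.\<close>
  have "(\<Sum>i=1..Suc k. \<alpha> i) \<le> 2 * \<alpha> 1 - \<alpha> (Suc k)"
  proof (induction k)
    case (Suc k)
    then show ?case using \<alpha>_Suc[of "Suc k"] by simp
  qed simp
  then show ?thesis using \<alpha>_1 \<alpha>_pos[of "Suc k"] Suc by simp
qed simp

lemma \<beta>_le: "\<beta> l \<le> 1"
proof -
  have "0 \<le> (\<Sum>i=1..l. \<alpha> i)" by (rule sum_nonneg) (use \<alpha>_pos in \<open>auto intro: less_imp_le\<close>)
  then show ?thesis by (simp add: \<beta>_def)
qed

lemma \<beta>_ge: "99 / 100 \<le> \<beta> l"
  using sum_\<alpha>_le[of l] by (simp add: \<beta>_def)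

section \<open>Representations of elements of the monoid\<close>

text \<open>\<open>rep r ls c N\<close>: the number \<open>r\<close> is the sum of the \<open>\<beta> l\<close> for \<open>l\<close> in \<open>ls\<close> and of the multiples
  \<open>c n * \<alpha> n\<close>; \<open>N\<close> bounds all indices involved.  A nonzero combination of the \<open>\<alpha> n\<close> lies in
  the submonoid generated by \<open>A2\<close> and \<open>A3\<close> exactly if some coefficient is at least 2.\<close>

definition rep :: "rat \<Rightarrow> nat list \<Rightarrow> (nat \<Rightarrow> nat) \<Rightarrow> nat \<Rightarrow> bool" where
  "rep r ls c N \<longleftrightarrow> (\<forall>l\<in>set ls. l \<le> N) \<and> (\<forall>n>N. c n = 0)
     \<and> ((\<forall>n\<ge>1. c n = 0) \<or> (\<exists>n\<ge>1. 2 \<le> c n))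
     \<and> r = sum_list (map \<beta> ls) + (\<Sum>n=1..N. of_nat (c n) * \<alpha> n)"

lemma rep_mono:
  assumes "rep r ls c N" "N \<le> N'"
  shows "rep r ls c N'"
proof -
  have "(\<Sum>n=1..N. of_nat (c n) * \<alpha> n) = (\<Sum>n=1..N'. of_nat (c n) * \<alpha> n)"
    using assms by (intro sum.mono_neutral_left) (auto simp: rep_def)
  with assms show ?thesis unfolding rep_def by auto
qed

lemma rep_add:
  assumes "rep r ls c N" "rep r' ls' c' N'"
  shows "rep (r + r') (ls @ ls') (\<lambda>n. c n + c' n) (max N N')"
proof -
  have "rep r ls c (max N N')" "rep r' ls' c' (max N N')"
    using assms by (auto intro: rep_mono)
  then show ?thesis
    unfolding rep_def by (auto simp: sum.distrib distrib_right intro: le_trans[OF _ le_add1] le_trans[OF _ le_add2])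
qed

lemma rep_zero: "rep 0 [] (\<lambda>_. 0) 0"
  by (simp add: rep_def)

lemma rep_\<beta>s: "rep (of_nat k * \<beta> L) (replicate k L) (\<lambda>_. 0) L"
  by (simp add: rep_def sum_list_replicate)

lemma rep_gen:
  assumes "x \<in> gens"
  shows "\<exists>ls c N. rep x ls c N"
proof (cases "x \<in> range \<beta>")
  case True
  then obtain l where "x = \<beta> l" by blast
  then have "rep x [l] (\<lambda>_. 0) l" by (simp add: rep_def)
  then show ?thesis by blast
next
  case False
  then obtain k m X where x: "x = of_nat k * \<alpha> m + sum \<alpha> X" and k: "k \<in> {1, 2}"
    and X: "finite X" "X \<subseteq> {1..}" "m \<in> X"
    using assms unfolding gens_def by auto
  \<comment> \<open>As \<open>m \<in> X\<close>, the coefficient at \<open>m\<close> is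
    \<open>k + 1\<close>, hence 2 or 3.\<close>
  define c where "c n = (if n = m then k else 0) + (if n \<in> X then 1 else 0)" for n
  have XN: "X \<subseteq> {1..Max X}" using X by auto
  then have "m \<in> {1..Max X}" using X(3) by blast
  have "(\<Sum>n=1..Max X. of_nat (c n) * \<alpha> n)
      = (\<Sum>n=1..Max X. (if n = m then of_nat k * \<alpha> m else 0) + (if n \<in> X then \<alpha> n else 0))"
    by (rule sum.cong) (auto simp: c_def algebra_simps)
  also have "\<dots> = of_nat k * \<alpha> m + (\<Sum>n=1..Max X. if n \<in> X then \<alpha> n else 0)"
    using \<open>m \<in> {1..Max X}\<close> by (simp add: sum.distrib)
  also have "(\<Sum>n=1..Max X. if n \<in> X then \<alpha> n else 0) = sum \<alpha> X"
    using XN by (simp add: sum.inter_restrict[symmetric] Int_absorb1)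
  finally have "x = (\<Sum>n=1..Max X. of_nat (c n) * \<alpha> n)" using x by simp
  moreover have "c m \<ge> 2" "1 \<le> m" using k X by (auto simp: c_def)
  moreover have "c n = 0" if "n > Max X" for n
    using that XN \<open>m \<in> {1..Max X}\<close> by (auto simp: c_def)
  ultimately have "rep x [] c (Max X)" by (auto simp: rep_def)
  then show ?thesis by blast
qed

lemma M_rep:
  assumes "r \<in> M"
  obtains ls c N where "rep r ls c N"
proof -
  from assms have "\<exists>ls c N. rep r ls c N"
  proof induction
    case zero
    show ?case using rep_zero by blast
  next
    case (gen x)
    then show ?case by (rule rep_gen)
  next
    case (add x y)
    then show ?case using rep_add by metis
  qed
  with that show thesis by blast
qed

text \<open>Coefficients 2 and 3 at \<open>m\<close> come from a generator whose set also contains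
  \<open>m\<close>; larger ones are reduced by splitting off \<open>2 * \<alpha> m\<close>.\<close>

lemma \<alpha>_combination_in_M:
  assumes "2 \<le> k" "1 \<le> m" "finite Y" "Y \<subseteq> {1..}" "m \<notin> Y"
  shows "of_nat k * \<alpha> m + sum \<alpha> Y \<in> M"
  using assms(1,3-)
proof (induction k arbitrary: Y rule: less_induct)
  case (less k)
  show ?case
  proof (cases "k \<le> 3")
    case True
    have "of_nat k * \<alpha> m + sum \<alpha> Y = of_nat (k - 1) * \<alpha> m + sum \<alpha> (insert m Y)"
      using less.prems by (simp add: of_nat_diff algebra_simps)
    also have "\<dots> \<in> gens"
    proof -
      have "k - 1 \<in> {1, 2}" using True less.prems by auto
      moreover have "finite (insert m Y)" "insert m Y \<subseteq> {1..}" "m \<in> insert m Y"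
        using less.prems assms(2) by auto
      ultimately show ?thesis unfolding gens_def by blast
    qed
    finally show ?thesis by (rule add_submonoid_gen.gen)
  next
    case False
    have "of_nat (k - 2) * \<alpha> m + sum \<alpha> Y \<in> M" using less.IH[of "k - 2" Y] less.prems False by simp
    moreover have "of_nat 2 * \<alpha> m + sum \<alpha> {} \<in> M" using less.IH[of 2 "{}"] less.prems False by simp
    ultimately have "(of_nat (k - 2) * \<alpha> m + sum \<alpha> Y) + (of_nat 2 * \<alpha> m + sum \<alpha> {}) \<in> M"
      by (rule add_submonoid_gen.add)
    then show ?thesis using False by (simp add: of_nat_diff algebra_simps)
  qed
qed

lemma rep_M:
  assumes "rep r ls c N"
  shows "r \<in> M"
proof -
  let ?f = "\<lambda>n. of_nat (c n) * \<alpha> n"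
  have "\<beta> l \<in> M" for l by (rule add_submonoid_gen.gen) (simp add: gens_def)
  then have "sum_list (map \<beta> ls) \<in> M"
    by (induction ls) (simp_all add: add_submonoid_gen.zero add_submonoid_gen.add)
  moreover have "sum ?f {1..N} \<in> M"
  proof (cases "\<forall>n\<ge>1. c n = 0")
    case True
    then show ?thesis by (simp add: add_submonoid_gen.zero)
  next
    case False
    with assms obtain m where m: "1 \<le> m" "2 \<le> c m" unfolding rep_def by blast
    then have "m \<in> {1..N}" using assms unfolding rep_def by (metis atLeastAtMost_iff not_le not_numeral_le_zero)
    \<comment> \<open>Coefficients 1 are available only next to a larger one, so \<open>Y\<close>
      joins the term at \<open>m\<close>; each term over \<open>Z\<close> is zero or lies in
      \<open>M\<close> by itself.\<close>
    define Y where "Y = {n \<in> {1..N} - {m}. c n = 1}"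
    define Z where "Z = {n \<in> {1..N} - {m}. c n \<noteq> 1}"
    have "sum ?f {1..N} = ?f m + sum ?f ({1..N} - {m})"
      using \<open>m \<in> {1..N}\<close> by (intro sum.remove) auto
    also have "{1..N} - {m} = Y \<union> Z" by (auto simp: Y_def Z_def)
    also have "sum ?f (Y \<union> Z) = sum ?f Y + sum ?f Z"
      by (rule sum.union_disjoint) (auto simp: Y_def Z_def)
    also have "sum ?f Y = sum \<alpha> Y" by (rule sum.cong) (auto simp: Y_def)
    finally have eq: "sum ?f {1..N} = (?f m + sum \<alpha> Y) + sum ?f Z" by (simp add: add.assoc)
    have "?f m + sum \<alpha> Y \<in> M"
      using m by (intro \<alpha>_combination_in_M) (auto simp: Y_def)
    moreover have "sum ?f Z \<in> M"
    proof (rule add_submonoid_gen_sum)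
      fix n assume n: "n \<in> Z"
      show "?f n \<in> M"
      proof (cases "c n = 0")
        case False
        then show ?thesis using \<alpha>_combination_in_M[of "c n" n "{}"] n by (auto simp: Z_def)
      qed (simp add: add_submonoid_gen.zero)
    qed
    ultimately show ?thesis unfolding eq by (rule add_submonoid_gen.add)
  qed
  ultimately show ?thesis
    using assms unfolding rep_def by (auto intro: add_submonoid_gen.add)
qed

lemma rep_bounds:
  assumes "rep r ls c N"
  shows "99 / 100 * of_nat (length ls) \<le> r" and "1 \<le> n \<Longrightarrow> of_nat (c n) * \<alpha> n \<le> r" and "0 \<le> r"
proof -
  let ?f = "\<lambda>n. of_nat (c n) * \<alpha> n"
  have b: "99 / 100 * of_nat (length ls) \<le> sum_list (map \<beta> ls)"
  proof (induction ls)
    case (Cons l ls)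
    then show ?case using \<beta>_ge[of l] by (simp add: algebra_simps)
  qed simp
  have f: "0 \<le> ?f n" if "n \<in> {1..N}" for n using that \<alpha>_pos[of n] by simp
  have r: "r = sum_list (map \<beta> ls) + sum ?f {1..N}" using assms by (simp add: rep_def)
  have s: "0 \<le> sum ?f {1..N}" using f by (rule sum_nonneg)
  show "99 / 100 * of_nat (length ls) \<le> r" using b r s by linarith
  have "0 \<le> sum_list (map \<beta> ls)" using b order_trans[OF _ b] by simp
  then show "0 \<le> r" using r s by simp
  show "?f n \<le> r" if "1 \<le> n"
  proof (cases "n \<le> N")
    case True
    have "?f n \<le> sum ?f {1..N}" using f True that by (intro member_le_sum) auto
    then show ?thesis using r \<open>0 \<le> sum_list _\<close> by simp
  next
    case False
    then have "c n = 0" using assms by (simp add: rep_def)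
    then show ?thesis using \<open>0 \<le> r\<close> by simp
  qed
qed

lemma M_nonneg: "r \<in> M \<Longrightarrow> 0 \<le> r"
  using M_rep rep_bounds(3) by metis

section \<open>Coefficients modulo \<open>p n\<close> and coordinates\<close>

text \<open>The multiplicity of \<open>\<alpha> n\<close> after each \<open>\<beta> l\<close> is expanded as \<open>1 - (\<Sum>i=1..l. \<alpha> i)\<close>.\<close>

definition coeff :: "nat list \<Rightarrow> (nat \<Rightarrow> nat) \<Rightarrow> nat \<Rightarrow> int" where
  "coeff ls c n = int (c n) - int (length (filter (\<lambda>l. n \<le> l) ls))"

lemma coeff_ge: "- int (length ls) \<le> coeff ls c n"
  using length_filter_le[of "\<lambda>l. n \<le> l" ls] unfolding coeff_def by linarith

lemma coeff_le: "coeff ls c n \<le> int (c n)"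
  unfolding coeff_def by simp

lemma coeff_append: "coeff (ls @ ls') (\<lambda>n. c n + c' n) n = coeff ls c n + coeff ls' c' n"
  by (simp add: coeff_def)

lemma coeff_beyond:
  assumes "rep r ls c N" "N < n"
  shows "coeff ls c n = 0"
proof -
  have "filter (\<lambda>l. n \<le> l) ls = []" using assms by (auto simp: rep_def filter_empty_conv)
  then show ?thesis using assms by (simp add: coeff_def rep_def)
qed

text \<open>This separates an integer from the \<open>\<alpha> n\<close>; the difference of two such
  expansions of the same number is the input of \<open>p_dvd_coefficient\<close>.\<close>

lemma rep_expand:
  assumes "rep r ls c N"
  shows "r = of_nat (length ls) + (\<Sum>n=1..N. of_int (coeff ls c n) * \<alpha> n)"
proof -
  have "sum_list (map \<beta> ls) = of_nat (length ls) * 1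
      + (\<Sum>n\<in>{1..N}. of_nat (length (filter (\<lambda>l. n \<le> l) ls)) * - \<alpha> n)"
  proof (rule sum_list_map_indicator_sum)
    fix l assume "l \<in> set ls"
    then have "(\<Sum>n=1..l. - \<alpha> n) = (\<Sum>n\<in>{1..N}. if n \<le> l then - \<alpha> n else 0)"
      using assms by (intro sum.mono_neutral_cong_left) (auto simp: rep_def)
    then show "\<beta> l = 1 + (\<Sum>n\<in>{1..N}. if n \<le> l then - \<alpha> n else 0)"
      by (simp add: \<beta>_def sum_negf)
  qed simp
  with assms show ?thesis
    by (simp add: rep_def coeff_def algebra_simps sum_subtractf sum_negf)
qed

text \<open>Multiplying by the product \<open>P\<close> of the other \<open>p m\<close> makes all
  terms but the one at \<open>n\<close> integers. So \<open>p n\<close> divides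
  \<open>P * d n * q n\<close>, but neither the smaller number \<open>q n\<close> nor
  \<open>P\<close>, a product of other primes.\<close>

lemma p_dvd_coefficient:
  assumes sum: "(\<Sum>m=1..N. of_int (d m) * \<alpha> m) = of_int z" and n: "n \<in> {1..N}"
  shows "int (p n) dvd d n"
proof -
  define R where "R = {1..N} - {n}"
  define P where "P = (\<Prod>m\<in>R. p m)"
  have int_term: "of_nat P * (of_int (d m) * \<alpha> m) \<in> \<int>" if "m \<in> R" for m
  proof -
    have "P = p m * (\<Prod>i\<in>R - {m}. p i)"
      unfolding P_def using that by (intro prod.remove) (auto simp: R_def)
    moreover have "p m \<noteq> 0" using p_pos[of m] that by (auto simp: R_def)
    ultimately have "of_nat P * (of_int (d m) * \<alpha> m)
        = of_int (int (\<Prod>i\<in>R - {m}. p i) * d m * int (q m))"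
      by (simp add: \<alpha>_eq)
    then show ?thesis by (metis Ints_of_int)
  qed
  have "of_int (d n) * \<alpha> n + (\<Sum>m\<in>R. of_int (d m) * \<alpha> m) = of_int z"
    using sum.remove[OF finite_atLeastAtMost n, of "\<lambda>m. of_int (d m) * \<alpha> m"] sum by (simp add: R_def)
  then have "of_nat P * (of_int (d n) * \<alpha> n)
      = of_nat P * of_int z - (\<Sum>m\<in>R. of_nat P * (of_int (d m) * \<alpha> m))"
    by (simp add: sum_distrib_left[symmetric] algebra_simps flip: distrib_left)
  also have "\<dots> \<in> \<int>"
    using int_term by (intro Ints_diff[OF Ints_mult Ints_sum]) auto
  finally obtain w where "of_nat P * (of_int (d n) * \<alpha> n) = of_int w" by (elim Ints_cases)
  moreover have "p n \<noteq> 0" using p_pos[of n] n by auto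
  ultimately have "(of_int (int P * d n * int (q n)) :: rat) = of_int (int (p n) * w)"
    by (simp add: \<alpha>_eq field_simps)
  then have "int P * d n * int (q n) = int (p n) * w" by (simp only: of_int_eq_iff)
  then have "int (p n) dvd int P * d n * int (q n)" by simp
  moreover have prime: "prime (int (p n))" using prime_p n by simp
  moreover have "\<not> int (p n) dvd int (q n)"
    using q_less_p[of n] prime_gt_0_nat[OF prime_q[of n]] n by (auto dest: dvd_imp_le)
  moreover have "\<not> int (p n) dvd int P"
  proof
    assume "int (p n) dvd int P"
    then have "p n dvd P" by simp
    moreover have "prime (p n)" "finite R" using prime_p n by (simp_all add: R_def)
    ultimately obtain m where m: "m \<in> R" "p n dvd p m"
      unfolding P_def by (auto simp: prime_dvd_prod_iff)
    then have "p n = p m" using prime_p n by (intro primes_dvd_imp_eq) (auto simp: R_def)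
    then show False using m(1) n p_less[of m n] p_less[of n m] by (cases m n rule: linorder_cases) (auto simp: R_def)
  qed
  ultimately show ?thesis by (simp add: prime_dvd_mult_iff)
qed

text \<open>Two representations of \<open>r\<close> have coefficients congruent modulo \<open>p n\<close>, and the coefficients
  are too small to differ when \<open>q n\<close> is large compared with \<open>r\<close>.\<close>

lemma coeff_unique:
  assumes rep: "rep r ls c N" "rep r ls' c' N'" and n: "1 \<le> n" "4 * r < of_nat (q n)"
  shows "coeff ls c n = coeff ls' c' n"
proof -
  have small: "2 * \<bar>coeff ls c n\<bar> < int (p n)" if "rep r ls c N" for ls c N
  proof -
    have pos: "0 < (of_nat (q n) :: rat)" "0 < (of_nat (p n) :: rat)"
      using p_pos[of n] q_ge[of n] n by auto
    have "of_nat (c n) * \<alpha> n \<le> r" using rep_bounds(2)[OF that n(1)] .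
    then have "4 * (of_nat (c n) * \<alpha> n) < of_nat (q n)" using n by linarith
    then have "4 * of_nat (c n) * of_nat (q n) < (of_nat (p n) * of_nat (q n) :: rat)"
      using pos by (simp add: \<alpha>_eq field_simps)
    then have "of_nat (4 * c n) < (of_nat (p n) :: rat)" using pos by simp
    then have c: "4 * c n < p n" by (simp only: of_nat_less_iff)
    have "2 * of_nat (length ls) < (of_nat (q n) :: rat)"
      using rep_bounds(1,3)[OF that] n(2) by linarith
    then have "of_nat (2 * length ls) < (of_nat (q n) :: rat)" by simp
    then have "2 * length ls < q n" by (simp only: of_nat_less_iff)
    then have "2 * length ls < p n" using q_less_p[OF n(1)] by simp
    then show ?thesis using c coeff_ge[of ls c n] coeff_le[of ls c n] by linarith
  qed
  let ?N = "max (max N N') n"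
  have rep': "rep r ls c ?N" "rep r ls' c' ?N" using rep by (auto intro: rep_mono)
  have "(\<Sum>m=1..?N. of_int (coeff ls c m - coeff ls' c' m) * \<alpha> m)
      = of_int (int (length ls') - int (length ls))"
    using rep_expand[OF rep'(1)] rep_expand[OF rep'(2)]
    by (simp add: algebra_simps sum_subtractf)
  then have "int (p n) dvd coeff ls c n - coeff ls' c' n"
    by (rule p_dvd_coefficient) (use n in simp)
  moreover have "\<bar>coeff ls c n - coeff ls' c' n\<bar> < int (p n)"
    using small[OF rep(1)] small[OF rep(2)] by linarith
  ultimately show ?thesis using dvd_imp_le_int[of "coeff ls c n - coeff ls' c' n" "int (p n)"] by auto
qed

text \<open>In general an arbitrary choice; for \<open>1 \<le> n\<close> and
  \<open>4 * r < q n\<close> it is independent of the representation by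
  \<open>coeff_unique\<close>.\<close>

definition coord :: "nat \<Rightarrow> rat \<Rightarrow> int" where
  "coord n r = (SOME z. \<exists>ls c N. rep r ls c N \<and> z = coeff ls c n)"

lemma coord_eq:
  assumes "rep r ls c N" "1 \<le> n" "4 * r < of_nat (q n)"
  shows "coord n r = coeff ls c n"
  unfolding coord_def
proof (rule some_equality)
  show "\<exists>ls' c' N. rep r ls' c' N \<and> coeff ls c n = coeff ls' c' n" using assms(1) by blast
next
  fix z assume "\<exists>ls c N. rep r ls c N \<and> z = coeff ls c n"
  then show "z = coeff ls c n" using coeff_unique[OF assms(1) _ assms(2,3)] by auto
qed

text \<open>Concatenating representations adds coefficients, and since \<open>u\<close> and
  \<open>v\<close> are nonnegative the bound on \<open>u + v\<close> covers both.\<close>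

lemma coord_add:
  assumes "u \<in> M" "v \<in> M" "1 \<le> n" "4 * (u + v) < of_nat (q n)"
  shows "coord n (u + v) = coord n u + coord n v"
proof -
  obtain ls c N ls' c' N' where reps: "rep u ls c N" "rep v ls' c' N'"
    using assms M_rep by metis
  have "4 * u \<le> 4 * (u + v)" "4 * v \<le> 4 * (u + v)"
    using rep_bounds(3)[OF reps(1)] rep_bounds(3)[OF reps(2)] by simp_all
  then have "4 * u < of_nat (q n)" "4 * v < of_nat (q n)"
    using assms(4) by (auto intro: le_less_trans)
  then show ?thesis
    using coord_eq[OF rep_add[OF reps] assms(3,4)] coord_eq[OF reps(1) assms(3)]
      coord_eq[OF reps(2) assms(3)] by (simp add: coeff_append)
qed

lemma coord_eventually_zero:
  assumes "r \<in> M"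
  shows "\<forall>\<^sub>F n in sequentially. coord n r = 0"
proof -
  obtain ls c N where rep: "rep r ls c N" using assms by (rule M_rep)
  show ?thesis
    using q_eventually_greater[of "4 * r"] eventually_gt_at_top[of N]
  proof eventually_elim
    case (elim n)
    then show ?case using coord_eq[OF rep, of n] coeff_beyond[OF rep, of n] by simp
  qed
qed

section \<open>Splitting off copies of \<open>\<beta> L\<close>\<close>

lemma \<beta>_indecomposable:
  assumes "u \<in> M" "v \<in> M" "u + v = \<beta> L"
  shows "u = 0 \<or> v = 0"
proof -
  \<comment> \<open>A nonzero \<open>u\<close> without \<open>\<beta>\<close> has a coefficient at
    least 2 at some \<open>n\<close>; \<open>v\<close> contributes at least -1 there, but the
    coefficients of \<open>\<beta> L\<close> are at most 0.\<close>
  have zero: "u = 0" if rep: "rep u [] c N" "rep v ls c' N'" "length ls \<le> 1" "u + v = \<beta> L"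
    for u v c N ls c' N'
  proof (rule ccontr)
    assume "u \<noteq> 0"
    then have "\<not> (\<forall>n\<ge>1. c n = 0)" using rep(1) by (auto simp: rep_def)
    then obtain n where n: "1 \<le> n" "2 \<le> c n" using rep(1) unfolding rep_def by blast
    \<comment> \<open>Uniqueness holds at every index \<open>n \<ge> 1\<close> here, because
      \<open>\<beta> L \<le> 1\<close> and \<open>q n > 100\<close>.\<close>
    have "4 * \<beta> L < of_nat 100" using \<beta>_le[of L] by simp
    also have "of_nat 100 < (of_nat (q n) :: rat)" using q_ge[OF n(1)] n(1) by (simp only: of_nat_less_iff)
    finally have "coeff ([] @ ls) (\<lambda>n. c n + c' n) n = coeff [L] (\<lambda>_. 0) n"
      using rep_add[OF rep(1,2)] rep_\<beta>s[of 1 L] rep(4) n(1)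
      by (intro coeff_unique) (auto simp: numeral_eq_Suc)
    moreover have "coeff ([] @ ls) (\<lambda>n. c n + c' n) n = int (c n) + coeff ls c' n"
      unfolding coeff_append by (simp add: coeff_def)
    moreover have "coeff [L] (\<lambda>_. 0) n \<le> 0" using coeff_le[of "[L]" "\<lambda>_. 0" n] by simp
    ultimately show False using n(2) coeff_ge[of ls c' n] rep(3) by linarith
  qed
  obtain ls c N ls' c' N' where reps: "rep u ls c N" "rep v ls' c' N'"
    using assms M_rep by metis
  \<comment> \<open>Two \<open>\<beta>\<close> would already exceed 1, so one of the summands has
    none.\<close>
  have "99 / 100 * of_nat (length ls + length ls') \<le> (1::rat)"
    using rep_bounds(1)[OF rep_add[OF reps]] assms(3) \<beta>_le[of L] by simp
  then have "of_nat (length ls + length ls') < (of_nat 2 :: rat)" by simp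
  then have len: "length ls + length ls' < 2" by (simp only: of_nat_less_iff)
  show ?thesis
  proof (cases ls)
    case Nil
    then show ?thesis using zero reps len assms(3) by auto
  next
    case (Cons l ks)
    then have "ls' = []" using len by simp
    then have "v = 0" using zero[of v c' N' u ls c N] reps len assms(3) by (simp add: add.commute)
    then show ?thesis ..
  qed
qed

text \<open>Since \<open>k \<ge> 2\<close>, replacing each \<open>\<beta> l\<close> by \<open>\<beta> L\<close> with \<open>L\<close> large adds the combination
  of the \<open>\<alpha> n\<close> that has a coefficient at least 2 at \<open>n = L\<close>.\<close>

lemma diff_\<beta>s_in_M:
  assumes rep: "rep r ls c N" and k: "2 \<le> k" "k \<le> length ls" and "N < L"
  shows "r - of_nat k * \<beta> L \<in> M"
proof -
  \<comment> \<open>Trading \<open>\<beta> l\<close> for \<open>\<beta> L\<close> releases the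
    \<open>\<alpha> n\<close> with \<open>l < n \<le> L\<close>, so \<open>c' n\<close> adds the
    number of entries below \<open>n\<close>.\<close>
  define c' where "c' n = (if n \<le> L then c n + length (filter (\<lambda>l. l < n) ls) else 0)" for n
  have ls_L: "\<forall>l\<in>set ls. l < L" using rep \<open>N < L\<close> by (auto simp: rep_def)
  have "sum_list (map \<beta> ls) = of_nat (length ls) * \<beta> L
      + (\<Sum>n\<in>{1..L}. of_nat (length (filter (\<lambda>l. l < n) ls)) * \<alpha> n)"
  proof (rule sum_list_map_indicator_sum)
    fix l assume "l \<in> set ls"
    then have l: "l < L" using ls_L by blast
    have "(\<Sum>n=1..L. \<alpha> n) = (\<Sum>n=1..L. (if l < n then \<alpha> n else 0) + (if n \<le> l then \<alpha> n else 0))"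
      by (rule sum.cong) auto
    also have "\<dots> = (\<Sum>n=1..L. if l < n then \<alpha> n else 0) + (\<Sum>n=1..L. if n \<le> l then \<alpha> n else 0)"
      by (rule sum.distrib)
    also have "(\<Sum>n=1..L. if n \<le> l then \<alpha> n else 0) = (\<Sum>n=1..l. \<alpha> n)"
      using l by (intro sum.mono_neutral_cong_right) auto
    finally show "\<beta> l = \<beta> L + (\<Sum>n\<in>{1..L}. if l < n then \<alpha> n else 0)" by (simp add: \<beta>_def)
  qed simp
  moreover have "(\<Sum>n=1..N. of_nat (c n) * \<alpha> n) = (\<Sum>n=1..L. of_nat (c n) * \<alpha> n)"
    using rep_mono[OF rep, of L] rep \<open>N < L\<close> by (simp add: rep_def)
  moreover have "(\<Sum>n=1..L. of_nat (c' n) * \<alpha> n) = (\<Sum>n=1..L. of_nat (c n) * \<alpha> n)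
      + (\<Sum>n=1..L. of_nat (length (filter (\<lambda>l. l < n) ls)) * \<alpha> n)"
    unfolding sum.distrib[symmetric] by (rule sum.cong) (auto simp: c'_def algebra_simps)
  ultimately have "r - of_nat k * \<beta> L
      = of_nat (length ls - k) * \<beta> L + (\<Sum>n=1..L. of_nat (c' n) * \<alpha> n)"
    using rep k by (simp add: rep_def of_nat_diff algebra_simps)
  moreover have "2 \<le> c' L" using k ls_L by (simp add: c'_def filter_True)
  moreover have "1 \<le> L" using \<open>N < L\<close> by simp
  ultimately have "rep (r - of_nat k * \<beta> L) (replicate (length ls - k) L) c' L"
    by (auto simp: rep_def sum_list_replicate c'_def)
  then show ?thesis by (rule rep_M)
qed

section \<open>A degree gap for divisors\<close>

text \<open>For large \<open>n\<close> the product \<open>g\<close> is homogeneous of degree 0 for \<open>coord n\<close>, hence so are its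
  factors.  Cofactors contain an exponent with at most one \<open>\<beta>\<close>, whose coordinate is
  at least -1.  Hence the coordinates of \<open>h\<close> at large \<open>n\<close> are at most 1, and a small nonzero exponent of
  \<open>h\<close> is only possible with a coordinate at least 2 at one of the finitely many other \<open>n\<close>.\<close>

lemma degree_gap:
  fixes g :: "rat \<Rightarrow>\<^sub>0 'a::field"
  assumes g: "g \<in> monoid_alg_nonzero M" and t: "t \<in> Poly_Mapping.keys g"
    and t_rep: "\<forall>ls c N. rep t ls c N \<longrightarrow> length ls \<le> 1"
  obtains \<delta> where "\<delta> > 0"
    "\<And>g' h. g' \<in> monoid_alg_nonzero M \<Longrightarrow> h \<in> monoid_alg_nonzero M \<Longrightarrow> g = g' * h \<Longrightarrow>
       Poly_Mapping.keys h = {0} \<or> \<delta> \<le> Max (Poly_Mapping.keys h)"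
proof -
  define D where "D = Max (Poly_Mapping.keys g)"
  have "\<forall>\<^sub>F n in sequentially. 1 \<le> n \<and> 4 * D < of_nat (q n) \<and> (\<forall>s\<in>Poly_Mapping.keys g. coord n s = 0)"
    using g by (intro eventually_conj eventually_ge_at_top q_eventually_greater
        eventually_ball_finite coord_eventually_zero ballI) (auto simp: monoid_alg_nonzero_def)
  then obtain n0 where n0: "\<And>n. n \<ge> n0 \<Longrightarrow> 1 \<le> n" "\<And>n. n \<ge> n0 \<Longrightarrow> 4 * D < of_nat (q n)"
    "\<And>n s. n \<ge> n0 \<Longrightarrow> s \<in> Poly_Mapping.keys g \<Longrightarrow> coord n s = 0"
    unfolding eventually_sequentially by blast
  \<comment> \<open>Below 1/2 no \<open>\<beta> l\<close> fits into an exponent; below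
    \<open>2 * \<alpha> n0\<close> no coefficient at least 2 fits at an index up to
    \<open>n0\<close>, as \<open>\<alpha>\<close> decreases.\<close>
  define \<delta> where "\<delta> = min (1 / 2) (2 * \<alpha> n0)"
  have "\<delta> > 0" using \<alpha>_pos[OF n0(1)] by (simp add: \<delta>_def)
  moreover have "Poly_Mapping.keys h = {0} \<or> \<delta> \<le> Max (Poly_Mapping.keys h)"
    if g': "g' \<in> monoid_alg_nonzero M" and h: "h \<in> monoid_alg_nonzero M" and gh: "g = g' * h"
    for g' h :: "rat \<Rightarrow>\<^sub>0 'a"
  proof (rule disjCI)
    assume small: "\<not> \<delta> \<le> Max (Poly_Mapping.keys h)"
    have nz: "g' \<noteq> 0" "h \<noteq> 0" and in_M: "\<And>u. u \<in> Poly_Mapping.keys g' \<Longrightarrow> u \<in> M"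
      "\<And>v. v \<in> Poly_Mapping.keys h \<Longrightarrow> v \<in> M"
      using g' h by (auto simp: monoid_alg_nonzero_def)
    have le_D: "u + v \<le> D" if "u \<in> Poly_Mapping.keys g'" "v \<in> Poly_Mapping.keys h" for u v
      using degree_mult[OF nz] that by (auto simp: D_def gh intro!: add_mono)
    obtain u w where u: "u \<in> Poly_Mapping.keys g'" and w: "w \<in> Poly_Mapping.keys h" and t_eq: "t = u + w"
      using keys_mult_sum t gh by metis
    obtain lu cu Nu where rep_u: "rep u lu cu Nu" using in_M(1)[OF u] by (rule M_rep)
    obtain lw cw Nw where rep_w: "rep w lw cw Nw" using in_M(2)[OF w] by (rule M_rep)
    \<comment> \<open>Otherwise concatenation with the representation of \<open>w\<close> would give
      \<open>t\<close> two or more \<open>\<beta>\<close>.\<close>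
    have len_u: "length lu \<le> 1" using t_rep rep_add[OF rep_u rep_w] t_eq by fastforce
    have "v = 0" if v: "v \<in> Poly_Mapping.keys h" for v
    proof (rule ccontr)
      assume "v \<noteq> 0"
      obtain ls c N where rep: "rep v ls c N" using in_M(2)[OF v] by (rule M_rep)
      have "v \<le> Max (Poly_Mapping.keys h)" using v by simp
      with small have v_small: "v < 1 / 2" "v < 2 * \<alpha> n0" by (auto simp: \<delta>_def)
      have "99 / 100 * of_nat (length ls) < (1 / 2 :: rat)"
        using rep_bounds(1)[OF rep] v_small by linarith
      then have "of_nat (length ls) < (of_nat 1 :: rat)" by linarith
      then have "length ls < 1" by (simp only: of_nat_less_iff)
      then have "ls = []" by simp
      with rep \<open>v \<noteq> 0\<close> have "\<not> (\<forall>n\<ge>1. c n = 0)" by (auto simp: rep_def)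
      then obtain n where n: "1 \<le> n" "2 \<le> c n" using rep unfolding rep_def by blast
      show False
      proof (cases "n \<le> n0")
        case True
        have "2 * \<alpha> n0 \<le> of_nat (c n) * \<alpha> n"
          using n \<alpha>_antimono[OF n(1) True] \<alpha>_pos[OF n0(1)[OF order_refl]] by (intro mult_mono) auto
        with rep_bounds(2)[OF rep n(1)] v_small show False by linarith
      next
        case False
        then have q: "4 * D < of_nat (q n)" and zero: "\<And>s. s \<in> Poly_Mapping.keys g \<Longrightarrow> coord n s = 0"
          using n0 by auto
        have q': "4 * (x + y) < of_nat (q n)" if "x \<in> Poly_Mapping.keys g'" "y \<in> Poly_Mapping.keys h" for x y
          using le_D[OF that] by (intro le_less_trans[OF _ q]) simp
        \<comment> \<open>\<open>D\<close> bounds all exponent sums, so \<open>coord n\<close> is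
          additive across the two supports.\<close>
        have "coord n u + coord n v = 0"
          using zero u v unfolding gh
          by (rule factor_of_homogeneous[rotated]) (use in_M n(1) q' coord_add in auto)
        moreover have "4 * u < of_nat (q n)" "4 * v < of_nat (q n)"
          using rep_bounds(3)[OF rep_u] rep_bounds(3)[OF rep]
          by (auto intro: le_less_trans[OF _ q'[OF u v]])
        then have "coord n u = coeff lu cu n" "coord n v = int (c n)"
          using coord_eq[OF rep_u n(1)] coord_eq[OF rep n(1)] \<open>ls = []\<close> by (auto simp: coeff_def)
        ultimately show False using coeff_ge[of lu cu n] len_u n(2) by linarith
      qed
    qed
    moreover have "Poly_Mapping.keys h \<noteq> {}" using nz by simp
    ultimately show "Poly_Mapping.keys h = {0}" by blast
  qed
  ultimately show thesis using that by blast
qed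

lemma accp_elem_monoid_alg:
  fixes g :: "rat \<Rightarrow>\<^sub>0 'a::field"
  assumes "g \<in> monoid_alg_nonzero M" "t \<in> Poly_Mapping.keys g"
    and "\<forall>ls c N. rep t ls c N \<longrightarrow> length ls \<le> 1"
  shows "accp_elem (monoid_alg_nonzero M) g"
proof -
  obtain \<delta> where \<delta>: "\<delta> > 0"
    "\<And>g' h. g' \<in> monoid_alg_nonzero M \<Longrightarrow> h \<in> monoid_alg_nonzero M \<Longrightarrow> g = g' * h \<Longrightarrow>
       Poly_Mapping.keys h = {0} \<or> \<delta> \<le> Max (Poly_Mapping.keys h)"
    using degree_gap[OF assms] by blast
  show ?thesis
  proof (rule accp_elem_of_degree_gap[OF _ _ _ assms(1) \<delta>(1)])
    fix g' h assume "g' \<in> monoid_alg_nonzero M" "h \<in> monoid_alg_nonzero M" "g = g' * h"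
    then show "Poly_Mapping.keys h = {0} \<or> \<delta> \<le> Max (Poly_Mapping.keys h)" by (rule \<delta>(2))
  qed (fact add_submonoid_gen.zero M_nonneg add_submonoid_gen.add)+
qed

section \<open>Reduction by a power of an atom\<close>

lemma atomic_monomial:
  "atomic_in (monoid_alg_nonzero M) (Poly_Mapping.single (of_nat k * \<beta> L) (1::'a::field))"
proof -
  let ?H = "monoid_alg_nonzero M :: (rat \<Rightarrow>\<^sub>0 'a) set"
  have M: "of_nat k * \<beta> L \<in> M" for k by (rule rep_M[OF rep_\<beta>s])
  have H: "Poly_Mapping.single (of_nat k * \<beta> L) (1::'a) \<in> ?H"
    using M by (simp add: monoid_alg_nonzero_def flip: keys_eq_empty)
  have atom: "atom_in ?H (Poly_Mapping.single (\<beta> L) 1)"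
  proof (rule monomial_atom)
    show "\<beta> L \<in> M" using M[of 1] by simp
    show "\<beta> L \<noteq> 0" using \<beta>_ge[of L] by auto
  qed (use M_nonneg \<beta>_indecomposable in \<open>auto intro: add_submonoid_gen.zero\<close>)
  have power: "Poly_Mapping.single (of_nat k * \<beta> L) (1::'a)
      = prod_list (replicate k (Poly_Mapping.single (\<beta> L) 1))"
  proof (induction k)
    case (Suc k)
    have "Poly_Mapping.single (of_nat (Suc k) * \<beta> L) (1::'a)
        = Poly_Mapping.single (\<beta> L) 1 * Poly_Mapping.single (of_nat k * \<beta> L) 1"
      by (simp add: mult_single algebra_simps)
    with Suc show ?case by simp
  qed simp
  show ?thesis
  \<comment> \<open>\<open>atomic_in\<close> excludes the empty product, so exponent 0 is treated as
    a unit.\<close>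
  proof (cases "k = 0")
    case True
    then show ?thesis using H by (auto simp: atomic_in_def intro!: monoid_alg_unit add_submonoid_gen.zero)
  next
    case False
    show ?thesis unfolding atomic_in_def
    proof (intro conjI disjI2 exI)
      show "replicate k (Poly_Mapping.single (\<beta> L) (1::'a)) \<noteq> []" using False by simp
      show "\<forall>x\<in>set (replicate k (Poly_Mapping.single (\<beta> L) 1)). atom_in ?H x" using atom by simp
    qed (rule H, rule power)
  qed
qed

text \<open>After division by the monomial, \<open>t0 - m\<close> is an exponent of the quotient of
  \<open>s\<close>, and it meets the condition of \<open>accp_elem_monoid_alg\<close>.\<close>

lemma almost_accp_of_monomial:
  fixes S :: "(rat \<Rightarrow>\<^sub>0 'a::field) set"
  assumes S: "S \<subseteq> monoid_alg_nonzero M" and m: "m = of_nat k * \<beta> L"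
    and dvd: "\<And>f t. f \<in> S \<Longrightarrow> t \<in> Poly_Mapping.keys f \<Longrightarrow> t - m \<in> M"
    and s: "s \<in> S" "t0 \<in> Poly_Mapping.keys s"
    and t0: "\<And>ls c N. rep (t0 - m) ls c N \<Longrightarrow> length ls \<le> 1"
  defines "H \<equiv> monoid_alg_nonzero M"
  shows "\<exists>d s. atomic_in H d \<and> (\<forall>x\<in>S. dvd_in H d x) \<and> s \<in> S
      \<and> (\<exists>c\<in>H. s = d * c \<and> accp_elem H c)"
proof -
  define d where "d = Poly_Mapping.single m (1::'a)"
  \<comment> \<open>The quotient is formed with exponent \<open>- m\<close> in the algebra with all
    rational exponents; only the shifted exponents must lie in \<open>M\<close>.\<close>
  define quot where "quot f = Poly_Mapping.single (- m) 1 * f" for f :: "rat \<Rightarrow>\<^sub>0 'a"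
  have d_quot: "f = d * quot f" for f
    by (simp add: d_def quot_def mult_single flip: mult.assoc)
  have keys_quot: "Poly_Mapping.keys (quot f) = (\<lambda>t. t - m) ` Poly_Mapping.keys f" for f
    unfolding quot_def keys_monomial_mult by (simp add: image_def)
  have quot_H: "quot f \<in> H" if "f \<in> S" for f
  proof -
    have "quot f \<noteq> 0" using d_quot[of f] that S by (auto simp: monoid_alg_nonzero_def)
    then show ?thesis using dvd that by (auto simp: H_def monoid_alg_nonzero_def keys_quot)
  qed
  have atomic: "atomic_in H d" unfolding H_def d_def m by (rule atomic_monomial)
  have "accp_elem H (quot s)"
    unfolding H_def using quot_H[OF s(1)] s(2) t0
    by (intro accp_elem_monoid_alg[where t = "t0 - m"]) (auto simp: H_def keys_quot)
  moreover have "dvd_in H d f" if "f \<in> S" for f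
    using that d_quot[of f] quot_H S atomic by (auto simp: dvd_in_def H_def atomic_in_def)
  ultimately show ?thesis using atomic s(1) d_quot quot_H by blast
qed

lemma almost_accp_monoid_alg: "almost_accp (monoid_alg_nonzero M :: (rat \<Rightarrow>\<^sub>0 'a::field) set)"
  unfolding almost_accp_def
proof (intro allI impI, elim conjE)
  fix S :: "(rat \<Rightarrow>\<^sub>0 'a) set"
  let ?H = "monoid_alg_nonzero M :: (rat \<Rightarrow>\<^sub>0 'a) set"
  assume S: "finite S" "S \<noteq> {}" "S \<subseteq> ?H"
  define T where "T = (\<Union>f\<in>S. Poly_Mapping.keys f)"
  have T: "finite T" "T \<subseteq> M" using S by (auto simp: T_def monoid_alg_nonzero_def)
  have "T \<noteq> {}" using S by (auto simp: T_def monoid_alg_nonzero_def)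
  then obtain t where "t \<in> T" by blast
  define P where "P k \<longleftrightarrow> (\<exists>t\<in>T. \<forall>ls c N. rep t ls c N \<longrightarrow> length ls \<le> k)" for k
  \<comment> \<open>Each \<open>\<beta> l\<close> is at least 99/100, so \<open>2 * t\<close> safely
    bounds their number; hence the least \<open>k\<close> exists.\<close>
  obtain b :: nat where b: "2 * t < of_nat b" using reals_Archimedean2 by blast
  have "P b"
    unfolding P_def
  proof (intro bexI[OF _ \<open>t \<in> T\<close>] allI impI)
    fix ls c N assume rep: "rep t ls c N"
    have "of_nat (length ls) < (of_nat b :: rat)"
      using rep_bounds(1,3)[OF rep] b by linarith
    then have "length ls < b" by (simp only: of_nat_less_iff)
    then show "length ls \<le> b" by simp
  qed
  define k where "k = (LEAST k. P k)"
  have "P k" unfolding k_def using \<open>P b\<close> by (rule LeastI)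
  then obtain t0 where t0: "t0 \<in> T" "\<And>ls c N. rep t0 ls c N \<Longrightarrow> length ls \<le> k"
    unfolding P_def by blast
  then obtain s where s: "s \<in> S" "t0 \<in> Poly_Mapping.keys s" by (auto simp: T_def)
  show "\<exists>d s. atomic_in ?H d \<and> (\<forall>x\<in>S. dvd_in ?H d x) \<and> s \<in> S \<and> (\<exists>c\<in>?H. s = d * c \<and> accp_elem ?H c)"
  \<comment> \<open>With at most one \<open>\<beta>\<close> the trivial divisor suffices;
    \<open>diff_\<beta>s_in_M\<close> is stated for \<open>k\<close> at least 2.\<close>
  proof (cases "k \<le> 1")
    case True
    show ?thesis
    proof (rule almost_accp_of_monomial[OF S(3) _ _ s, where m = 0 and k = 0])
      fix ls c N assume "rep (t0 - 0) ls c N"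
      then have "length ls \<le> k" by (intro t0(2)) simp
      with True show "length ls \<le> 1" by simp
    qed (use S(3) in \<open>auto simp: monoid_alg_nonzero_def\<close>)
  next
    case False
    \<comment> \<open>By minimality of \<open>k\<close>, no exponent is limited to fewer than
      \<open>k\<close> of the \<open>\<beta>\<close>.\<close>
    have "\<exists>N ls c. rep t ls c N \<and> k \<le> length ls" if t: "t \<in> T" for t
    proof -
      have "\<not> P (k - 1)" unfolding k_def using False by (intro not_less_Least) (simp add: k_def)
      then obtain N ls c where "rep t ls c N" "\<not> length ls \<le> k - 1"
        using t unfolding P_def by blast
      then show ?thesis by (intro exI[of _ N] exI[of _ ls] exI[of _ c]) auto
    qed
    then obtain N where N: "\<And>t. t \<in> T \<Longrightarrow> \<exists>ls c. rep t ls c (N t) \<and> k \<le> length ls" by metis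
    define L where "L = Suc (Max (N ` T))"
    have NL: "N t < L" if "t \<in> T" for t using T(1) that by (simp add: L_def less_Suc_eq_le)
    show ?thesis
    proof (rule almost_accp_of_monomial[OF S(3) refl _ s, where L = L and k = k])
      fix f t assume "f \<in> S" "t \<in> Poly_Mapping.keys f"
      then have "t \<in> T" by (auto simp: T_def)
      with N NL False show "t - of_nat k * \<beta> L \<in> M" by (metis diff_\<beta>s_in_M not_less_eq_eq numeral_2_eq_2 One_nat_def)
    next
      fix ls c N assume "rep (t0 - of_nat k * \<beta> L) ls c N"
      \<comment> \<open>Restoring the \<open>k\<close> copies of \<open>\<beta> L\<close> represents
        \<open>t0\<close>, so \<open>ls\<close> is even empty.\<close>
      from rep_add[OF this rep_\<beta>s[of k L]] have "length (ls @ replicate k L) \<le> k"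
        by (intro t0(2)) simp
      then show "length ls \<le> 1" by simp
    qed
  qed
qed

end

section \<open>The generators in their stated form\<close>

theorem theorem5p13:
  fixes p q :: "nat \<Rightarrow> nat" and \<alpha> :: "nat \<Rightarrow> rat"
    and A2 A3 B M :: "rat set"
  assumes primes: "\<forall>n\<ge>1. prime (p n) \<and> prime (q n)"
    and p_incr: "\<forall>n\<ge>1. p n < p (Suc n)"
    and q_incr: "\<forall>n\<ge>1. q n < q (Suc n)"
    and q1: "100 < q 1"
    and interlace: "\<forall>n\<ge>1. q n < p n \<and> p n < q (Suc n)"
    and alpha_def: "\<forall>n. \<alpha> n = of_nat (q n) / of_nat (p n)"
    and alpha1: "\<alpha> 1 < 1 / 200"
    and alpha_decr: "\<forall>n\<ge>1. \<alpha> (Suc n) < \<alpha> n / 2"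
    and A2_def: "A2 = {\<alpha> (j k) + (\<Sum>i=1..l. \<alpha> (j i)) | (l::nat) (k::nat) (j::nat \<Rightarrow> nat).
                   1 \<le> l \<and> 1 \<le> k \<and> k \<le> l \<and> (\<forall>i\<in>{1..l}. 1 \<le> j i) \<and> inj_on j {1..l}}"
    and A3_def: "A3 = {2 * \<alpha> (j k) + (\<Sum>i=1..l. \<alpha> (j i)) | (l::nat) (k::nat) (j::nat \<Rightarrow> nat).
                   1 \<le> l \<and> 1 \<le> k \<and> k \<le> l \<and> (\<forall>i\<in>{1..l}. 1 \<le> j i) \<and> inj_on j {1..l}}"
    and B_def: "B = {1} \<union> {1 - (\<Sum>i=1..l. \<alpha> i) | l. 1 \<le> l}"
    and M_def: "M = add_submonoid_gen (A2 \<union> A3 \<union> B)"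
  shows "domain_almost_accp_monoid_alg M TYPE('a::field)"
proof -
  interpret prime_ratios p q \<alpha>
    by unfold_locales (use primes p_incr q_incr q1 interlace alpha_def alpha1 alpha_decr in auto)
  \<comment> \<open>\<open>C 1\<close> and \<open>C 2\<close> are the set versions of
    \<open>A2\<close> and \<open>A3\<close>; enumerating \<open>X\<close>, or taking the image of
    \<open>j\<close>, passes between the two forms.\<close>
  define C where "C r = {of_nat r * \<alpha> m + sum \<alpha> X | m X. finite X \<and> X \<subseteq> {1..} \<and> m \<in> X}" for r
  have C: "C r = {of_nat r * \<alpha> (j k) + (\<Sum>i=1..l. \<alpha> (j i)) | (l::nat) (k::nat) (j::nat \<Rightarrow> nat).
        1 \<le> l \<and> 1 \<le> k \<and> k \<le> l \<and> (\<forall>i\<in>{1..l}. 1 \<le> j i) \<and> inj_on j {1..l}}" (is "_ = ?L") for r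
  proof (intro equalityI subsetI)
    fix x assume "x \<in> C r"
    then obtain m X where x: "x = of_nat r * \<alpha> m + sum \<alpha> X" and X: "finite X" "X \<subseteq> {1..}" "m \<in> X"
      unfolding C_def by blast
    obtain j where j: "bij_betw j {1..card X} X" using ex_bij_betw_nat_finite_1[OF X(1)] by blast
    then obtain k where k: "k \<in> {1..card X}" "m = j k" using X(3) unfolding bij_betw_def by blast
    have "x = of_nat r * \<alpha> (j k) + (\<Sum>i=1..card X. \<alpha> (j i))"
      using x k(2) sum.reindex_bij_betw[OF j, of \<alpha>] by simp
    moreover have "1 \<le> card X \<and> 1 \<le> k \<and> k \<le> card X \<and> (\<forall>i\<in>{1..card X}. 1 \<le> j i) \<and> inj_on j {1..card X}"
      using j k(1) X(2) by (auto simp: bij_betw_def)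
    ultimately show "x \<in> ?L" by blast
  next
    fix x assume "x \<in> ?L"
    then obtain l k :: nat and j where x: "x = of_nat r * \<alpha> (j k) + (\<Sum>i=1..l. \<alpha> (j i))"
      and "1 \<le> k \<and> k \<le> l" and j: "\<forall>i\<in>{1..l}. 1 \<le> j i" "inj_on j {1..l}" by blast
    then have k: "k \<in> {1..l}" by simp
    have "x = of_nat r * \<alpha> (j k) + sum \<alpha> (j ` {1..l})"
      using x j(2) by (simp add: sum.reindex)
    moreover have "finite (j ` {1..l})" "j ` {1..l} \<subseteq> {1..}" "j k \<in> j ` {1..l}" using k j(1) by auto
    ultimately show "x \<in> C r" unfolding C_def by blast
  qed
  have "A2 = C 1" "A3 = C 2" unfolding A2_def A3_def C by simp_all
  moreover have "gens = C 1 \<union> C 2 \<union> range \<beta>" unfolding gens_def C_def by blast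
  moreover have "B = range \<beta>"
  proof (intro equalityI subsetI)
    fix x assume "x \<in> B"
    then consider "x = 1" | l where "x = 1 - (\<Sum>i=1..l. \<alpha> i)" unfolding B_def by blast
    then show "x \<in> range \<beta>"
    proof cases
      case 1
      then have "x = \<beta> 0" by (simp add: \<beta>_def)
      then show ?thesis by blast
    next
      case (2 l)
      then have "x = \<beta> l" by (simp add: \<beta>_def)
      then show ?thesis by blast
    qed
  next
    fix x assume "x \<in> range \<beta>"
    then obtain l where "x = \<beta> l" by blast
    then show "x \<in> B" by (cases "l = 0") (auto simp: B_def \<beta>_def)
  qed
  ultimately have "A2 \<union> A3 \<union> B = gens" by simp
  then show ?thesis
    using almost_accp_monoid_alg unfolding domain_almost_accp_monoid_alg_def M_def by simp
qed

end
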